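(* The function $\mathrm{Or}$ on $n$ qubits can be reduced exactly to $\mathrm{Or}$ on $m=\lceil\log_2(n+1)\rceil$ qubits in constant depth and size $O(n\log n)$. That is, there are quantum circuits with fan-out of constant depth and size $O(n\log n)$ mapping $|x\rangle|0^m\rangle\mapsto|x\rangle|\varphi_x\rangle$ for every $x\in\{0,1\}^n$, where $|\varphi_x\rangle=|0^m\rangle$ if $|x|=0$, and $\langle0^m|\varphi_x\rangle=0$ if $|x|\ne0$.
   Context: $|x|$ denotes the Hamming weight of a bit string $x$. A quantum circuit is a sequence of layers of quantum gates; gates in one layer act on disjoint qubits. The size of a gate is the number of qubits it acts on, the depth of a circuit is its number of layers, and its size is the total size of its gates. A circuit may use ancilla qubits initialised to $|0\rangle$, which are returned to $|0\rangle$. The (unbounded) fan-out gate maps $|y_1\rangle\cdots|y_k\rangle|x\rangle\mapsto|y_1\oplus x\rangle\cdots|y_k\oplus x\rangle|x\rangle$, for any $k$, and counts as one gate. A quantum circuit with fan-out uses one-qubit gates, controlled-not gates and fan-out gates; here arbitrary one-qubit gates are allowed. *)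

theory Defs
  imports "HOL-Analysis.Analysis" "HOL-Library.Landau_Symbols"
begin

type_synonym bits = "bool list"

text \<open>A vector of the space of \<open>N\<close> qubits is given by its amplitudes in the computational basis; it
  vanishes on all lists whose length is not \<open>N\<close>.\<close>

type_synonym amplitudes = "bits \<Rightarrow> complex"

definition ket :: "bits \<Rightarrow> amplitudes" where
  "ket x = (\<lambda>z. if z = x then 1 else 0)"

definition zeros :: "nat \<Rightarrow> bits" where
  "zeros k = replicate k False"

definition hamming_weight :: "bits \<Rightarrow> nat" where
  "hamming_weight x = count_list x True"

definition braket :: "nat \<Rightarrow> amplitudes \<Rightarrow> amplitudes \<Rightarrow> complex" where
  "braket N \<psi> \<phi> = (\<Sum>z | length z = N. cnj (\<psi> z) * \<phi> z)"

definition quantum_state :: "nat \<Rightarrow> amplitudes \<Rightarrow> bool" where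
  "quantum_state N \<psi> \<longleftrightarrow> (\<forall>z. length z \<noteq> N \<longrightarrow> \<psi> z = 0) \<and> braket N \<psi> \<psi> = 1"

text \<open>Tensor product of a vector on \<open>k\<close> qubits (first factor) with a vector on further qubits.\<close>

definition tensor :: "nat \<Rightarrow> amplitudes \<Rightarrow> amplitudes \<Rightarrow> amplitudes" where
  "tensor k \<psi> \<phi> = (\<lambda>z. \<psi> (take k z) * \<phi> (drop k z))"

definition unitary :: "complex^bool^bool \<Rightarrow> bool" where
  "unitary U \<longleftrightarrow> (let U' = (\<chi> i j. cnj (U $ j $ i)) in U ** U' = mat 1 \<and> U' ** U = mat 1)"

text \<open>The arguments are: matrix and qubit; target and control; list of targets and control.\<close>

datatype gate =
    One_Qubit "complex^bool^bool" nat
  | CNOT nat nat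
  | Fan_Out "nat list" nat

fun gate_qubits :: "gate \<Rightarrow> nat list" where
  "gate_qubits (One_Qubit U q) = [q]"
| "gate_qubits (CNOT t c) = [t, c]"
| "gate_qubits (Fan_Out ts c) = ts @ [c]"

fun gate_unitary :: "gate \<Rightarrow> bool" where
  "gate_unitary (One_Qubit U q) \<longleftrightarrow> unitary U"
| "gate_unitary (CNOT t c) \<longleftrightarrow> True"
| "gate_unitary (Fan_Out ts c) \<longleftrightarrow> True"

definition gate_size :: "gate \<Rightarrow> nat" where
  "gate_size g = length (gate_qubits g)"

text \<open>The image of a basis vector under a gate. On \<^typ>\<open>bool\<close>, inequality is exclusive or.\<close>

fun gate_ket :: "gate \<Rightarrow> bits \<Rightarrow> amplitudes" where
  "gate_ket (One_Qubit U q) y = (\<lambda>z. \<Sum>b\<in>UNIV. U $ b $ (y ! q) * ket (y[q := b]) z)"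
| "gate_ket (CNOT t c) y = ket (y[t := (y ! t \<noteq> y ! c)])"
| "gate_ket (Fan_Out ts c) y =
     ket (map (\<lambda>i. if i \<in> set ts then y ! i \<noteq> y ! c else y ! i) [0..<length y])"

text \<open>Linear extension. Gates preserve the number of qubits, so for the amplitude at \<open>z\<close> only basis
  vectors of the length of \<open>z\<close> matter.\<close>

definition apply_gate :: "gate \<Rightarrow> amplitudes \<Rightarrow> amplitudes" where
  "apply_gate g \<psi> = (\<lambda>z. \<Sum>y | length y = length z. \<psi> y * gate_ket g y z)"

lemma gate_ket_length: "length z \<noteq> length y \<Longrightarrow> gate_ket g y z = 0"
  by (cases g) (auto simp: ket_def intro!: sum.neutral)

lemma apply_gate_ket: "apply_gate g (ket y) = gate_ket g y"
proof
  fix z :: bits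
  have "finite {w :: bits. length w = length z}"
    using finite_lists_length_eq[of "UNIV :: bool set" "length z"] by simp
  then have "apply_gate g (ket y) z = (if length y = length z then gate_ket g y z else 0)"
    by (simp add: apply_gate_def ket_def of_bool_def[symmetric] if_distrib[of "\<lambda>u. u * _"]
        cong: if_cong)
  then show "apply_gate g (ket y) z = gate_ket g y z"
    using gate_ket_length[of z y g] by auto
qed

text \<open>The gates of a layer act on disjoint qubits, so their order within the list is irrelevant.\<close>

type_synonym layer = "gate list"
type_synonym circuit = "layer list"

definition valid_layer :: "nat \<Rightarrow> layer \<Rightarrow> bool" where
  "valid_layer N L \<longleftrightarrow> (\<forall>g\<in>set L. gate_unitary g) \<and>
     distinct (concat (map gate_qubits L)) \<and> set (concat (map gate_qubits L)) \<subseteq> {..<N}"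

definition valid_circuit :: "nat \<Rightarrow> circuit \<Rightarrow> bool" where
  "valid_circuit N C \<longleftrightarrow> (\<forall>L\<in>set C. valid_layer N L)"

definition circuit_depth :: "circuit \<Rightarrow> nat" where
  "circuit_depth C = length C"

definition circuit_size :: "circuit \<Rightarrow> nat" where
  "circuit_size C = (\<Sum>L\<leftarrow>C. \<Sum>g\<leftarrow>L. gate_size g)"

definition run_layer :: "layer \<Rightarrow> amplitudes \<Rightarrow> amplitudes" where
  "run_layer L \<psi> = fold apply_gate L \<psi>"

definition run_circuit :: "circuit \<Rightarrow> amplitudes \<Rightarrow> amplitudes" where
  "run_circuit C \<psi> = fold run_layer C \<psi>"

text \<open>A circuit on \<open>k\<close> work qubits and \<open>a\<close> ancillas (placed last) maps \<open>\<psi>\<close> to \<open>\<phi>\<close>, with the ancillas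
  starting and ending in the zero state.\<close>

definition maps_to :: "nat \<Rightarrow> nat \<Rightarrow> circuit \<Rightarrow> amplitudes \<Rightarrow> amplitudes \<Rightarrow> bool" where
  "maps_to k a C \<psi> \<phi> \<longleftrightarrow>
     run_circuit C (tensor k \<psi> (ket (zeros a))) = tensor k \<phi> (ket (zeros a))"

definition reduces_Or_exactly :: "nat \<Rightarrow> nat \<Rightarrow> nat \<Rightarrow> circuit \<Rightarrow> bool" where
  "reduces_Or_exactly n m a C \<longleftrightarrow>
     (\<forall>x. length x = n \<longrightarrow> (\<exists>\<phi>. quantum_state m \<phi> \<and>
        maps_to (n + m) a C (tensor n (ket x) (ket (zeros m))) (tensor n (ket x) \<phi>) \<and>
        (hamming_weight x = 0 \<longrightarrow> \<phi> = ket (zeros m)) \<and>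
        (hamming_weight x \<noteq> 0 \<longrightarrow> braket m (ket (zeros m)) \<phi> = 0)))"

end

theory Submission imports Defs begin

text \<open>The output qubit \<open>k < m\<close> is rotated to
  \<open>cos (w \<theta>) |0\<rangle> - i sin (w \<theta>) |1\<rangle>\<close> with \<open>\<theta> = \<pi> / 2 ^ (k + 1)\<close> and \<open>w = |x|\<close>. If
  \<open>w = 2 ^ k u\<close> with \<open>u\<close> odd, then \<open>k < m\<close> and the amplitude of \<open>|0\<rangle>\<close> on the output qubit \<open>k\<close>
  vanishes.

  To rotate in constant depth, output qubit \<open>k\<close>, in state \<open>|y\<rangle>\<close> after a Hadamard gate, and the input
  are fanned out into \<open>n\<close> ancillas, which then hold the bits \<open>x\<^sub>i \<oplus> y\<close>. The phase gates of angle
  \<open>-\<theta>\<close> on these contribute the phase \<open>-w \<theta>\<close> if \<open>y = 0\<close> and \<open>-(n - w) \<theta>\<close> if \<open>y = 1\<close>; a phase gate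
  of angle \<open>n \<theta>\<close> on the output qubit turns the latter into \<open>w \<theta>\<close>. Undoing the fan-outs and a second
  Hadamard gate finish the rotation. So no controlled rotations are needed.\<close>

section \<open>Pointwise action of single gates\<close>

lemma finite_bits: "finite {y :: bits. length y = l}"
  using finite_lists_length_eq[of "UNIV :: bool set" l] by simp

text \<open>Only the two strings that agree with \<open>z\<close> off position \<open>q\<close> have
  an image with nonzero amplitude at \<open>z\<close>, so the sum in \<open>apply_gate\<close>
  collapses to row \<open>z ! q\<close> of \<open>U\<close>.\<close>

lemma apply_One_Qubit:
  assumes "q < length z"
  shows "apply_gate (One_Qubit U q) \<psi> z = (\<Sum>b\<in>UNIV. U $ (z ! q) $ b * \<psi> (z[q := b]))"
proof -
  let ?A = "{z[q := True], z[q := False]}"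
  let ?f = "\<lambda>y. \<psi> y * (\<Sum>b\<in>UNIV. U $ b $ (y ! q) * ket (y[q := b]) z)"
  have ne: "z[q := True] \<noteq> z[q := False]"
    using assms by (metis nth_list_update_eq)
  have "?f y = 0" if "y \<notin> ?A" for y
  proof -
    have "z \<noteq> y[q := b]" for b
    proof
      assume "z = y[q := b]"
      then have "y = z[q := y ! q]"
        by simp
      with that show False
        by (cases "y ! q") auto
    qed
    then show ?thesis
      by (simp add: ket_def)
  qed
  then have "apply_gate (One_Qubit U q) \<psi> z = sum ?f ?A"
    unfolding apply_gate_def gate_ket.simps
    by (intro sum.mono_neutral_right finite_bits) auto
  also have "\<dots> = ?f (z[q := True]) + ?f (z[q := False])"
    using ne by simp
  also have "\<dots> = (\<Sum>b\<in>UNIV. U $ (z ! q) $ b * \<psi> (z[q := b]))"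
  proof -
    have "ket (z[q := b]) z = (if z ! q = b then 1 else 0)" for b
      using assms list_update_same_conv[of q z b] by (auto simp: ket_def)
    then show ?thesis
      using assms by (cases "z ! q") (simp_all add: UNIV_bool mult.commute)
  qed
  finally show ?thesis .
qed

text \<open>As the control is not a target, the gate permutes the basis strings by an involution;
  hence pulling an amplitude back uses the same map as pushing a basis vector forward.\<close>

lemma apply_Fan_Out:
  assumes "c < length z" "c \<notin> set ts"
  shows "apply_gate (Fan_Out ts c) \<psi> z =
    \<psi> (map (\<lambda>i. if i \<in> set ts then z ! i \<noteq> z ! c else z ! i) [0..<length z])"
proof -
  define s where "s y = map (\<lambda>i. if i \<in> set ts then y ! i \<noteq> y ! c else y ! i) [0..<length y]" for y
  have inv: "s (s y) = y" if "length y = length z" for y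
    using that assms by (auto simp: s_def intro!: nth_equalityI)
  have len: "length (s y) = length y" for y
    by (simp add: s_def)
  have "apply_gate (Fan_Out ts c) \<psi> z = (\<Sum>y | length y = length z. \<psi> y * ket (s y) z)"
    by (simp add: apply_gate_def s_def)
  also have "\<dots> = (\<Sum>y | length y = length z. if y = s z then \<psi> y else 0)"
    using inv by (intro sum.cong) (auto simp: ket_def)
  also have "\<dots> = \<psi> (s z)"
    using finite_bits by (simp add: len)
  finally show ?thesis
    by (simp add: s_def)
qed

lemma run_layer_support:
  assumes "\<And>z. length z \<noteq> N \<Longrightarrow> \<psi> z = 0" "length z \<noteq> N"
  shows "run_layer L \<psi> z = 0"
  using assms unfolding run_layer_def
proof (induction L arbitrary: \<psi> z)
  case (Cons g L)
  have "apply_gate g \<psi> z = 0" if "length z \<noteq> N" for z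
    unfolding apply_gate_def using that Cons.prems(1) by (intro sum.neutral) auto
  then show ?case
    using Cons by simp
qed simp

section \<open>Size in terms of depth and number of qubits\<close>

lemma valid_layer_size:
  assumes "valid_layer N L"
  shows "(\<Sum>g\<leftarrow>L. gate_size g) \<le> N"
proof -
  let ?qs = "concat (map gate_qubits L)"
  have "(\<Sum>g\<leftarrow>L. gate_size g) = length ?qs"
    by (simp add: gate_size_def length_concat comp_def)
  \<comment> \<open>Disjointness of the gates: no qubit is counted twice.\<close>
  also have "\<dots> = card (set ?qs)"
    using assms by (simp only: valid_layer_def distinct_card)
  also have "\<dots> \<le> card {..<N}"
    using assms by (intro card_mono) (auto simp: valid_layer_def)
  finally show ?thesis
    by simp
qed

text \<open>This reduces the size estimate to constant depth and \<open>O(n log n)\<close> qubits;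
  no gates have to be counted.\<close>

lemma valid_circuit_size:
  assumes "valid_circuit N C"
  shows "circuit_size C \<le> circuit_depth C * N"
  using assms
proof (induction C)
  case (Cons L C)
  then show ?case
    using valid_layer_size[of N L]
    by (simp add: valid_circuit_def circuit_size_def circuit_depth_def add_mono)
qed (simp add: circuit_size_def)

lemma run_circuit_Nil: "run_circuit [] \<psi> = \<psi>"
  by (simp add: run_circuit_def)

lemma run_circuit_Cons: "run_circuit (L # C) \<psi> = run_circuit C (run_layer L \<psi>)"
  by (simp add: run_circuit_def)

lemma run_circuit_append: "run_circuit (C @ D) \<psi> = run_circuit D (run_circuit C \<psi>)"
  by (simp add: run_circuit_def)

section \<open>Layers of one-qubit gates and of fan-out gates\<close>

definition hadamard :: "complex^bool^bool" where
  "hadamard = (\<chi> i j. (if i \<and> j then -1 else 1) / complex_of_real (sqrt 2))"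

definition phase :: "real \<Rightarrow> complex^bool^bool" where
  "phase t = (\<chi> i j. if i = j then if i then cis t else 1 else 0)"

lemma unitary_hadamard: "unitary hadamard"
  by (simp add: unitary_def hadamard_def matrix_matrix_mult_def mat_def vec_eq_iff UNIV_bool all_bool_eq
      flip: of_real_mult)

lemma unitary_phase: "unitary (phase t)"
  by (simp add: unitary_def phase_def matrix_matrix_mult_def mat_def vec_eq_iff UNIV_bool all_bool_eq
      cis_cnj cis_mult)

definition one_qubit_layer :: "(nat \<Rightarrow> complex^bool^bool) \<Rightarrow> nat \<Rightarrow> nat \<Rightarrow> layer" where
  "one_qubit_layer U p l = map (\<lambda>k. One_Qubit (U k) (p + k)) [0..<l]"

lemma valid_one_qubit_layer:
  assumes "\<And>k. k < l \<Longrightarrow> unitary (U k)" "p + l \<le> N"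
  shows "valid_layer N (one_qubit_layer U p l)"
proof -
  have "concat (map gate_qubits (one_qubit_layer U p l)) = map ((+) p) [0..<l]"
    by (induction l) (simp_all add: one_qubit_layer_def)
  then show ?thesis
    using assms by (auto simp: valid_layer_def one_qubit_layer_def distinct_map)
qed

lemma run_phase_layer:
  assumes "p + l \<le> length z"
  shows "run_layer (one_qubit_layer (\<lambda>k. phase (t k)) p l) \<psi> z =
    (\<Prod>k<l. if z ! (p + k) then cis (t k) else 1) * \<psi> z"
  using assms
proof (induction l)
  case (Suc l)
  have upd: "z[p + l := b] = z" if "z ! (p + l) = b" for b
    unfolding that[symmetric] by (rule list_update_id)
  show ?case
    using Suc upd
    by (cases "z ! (p + l)")
      (simp_all add: run_layer_def one_qubit_layer_def apply_One_Qubit UNIV_bool phase_def)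
qed (simp add: run_layer_def one_qubit_layer_def)

text \<open>Encoding the wiring as a function \<open>c\<close> from targets to controls makes the
  target lists of different gates disjoint automatically.\<close>

definition fan_out_layer :: "(nat \<Rightarrow> nat) \<Rightarrow> nat \<Rightarrow> nat \<Rightarrow> nat list \<Rightarrow> layer" where
  "fan_out_layer c p N cs = map (\<lambda>i. Fan_Out (filter (\<lambda>q. c q = i) [p..<N]) i) cs"

lemma valid_fan_out_layer:
  assumes "distinct cs" "set cs \<subseteq> {..<p}" "p \<le> N"
  shows "valid_layer N (fan_out_layer c p N cs)"
proof -
  have "distinct (concat (map gate_qubits (fan_out_layer c p N cs)))"
    using assms(1,2) by (induction cs) (auto simp: fan_out_layer_def)
  then show ?thesis
    using assms by (auto simp: valid_layer_def fan_out_layer_def)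
qed

definition xor_from :: "(nat \<Rightarrow> nat) \<Rightarrow> nat \<Rightarrow> bits \<Rightarrow> bits" where
  "xor_from c p z = map (\<lambda>q. if q < p then z ! q else z ! q \<noteq> z ! c q) [0..<length z]"

lemma length_xor_from [simp]: "length (xor_from c p z) = length z"
  by (simp add: xor_from_def)

lemma nth_xor_from:
  "q < length z \<Longrightarrow> xor_from c p z ! q = (if q < p then z ! q else z ! q \<noteq> z ! c q)"
  by (simp add: xor_from_def)

text \<open>The controls lie below \<open>p\<close>, where nothing changes, so every target receives
  the same bit twice. This is what uncomputes the ancillas.\<close>

lemma xor_from_involution:
  assumes "\<And>q. p \<le> q \<Longrightarrow> q < length z \<Longrightarrow> c q < p"
  shows "xor_from c p (xor_from c p z) = z"
proof (rule nth_equalityI)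
  fix q assume "q < length (xor_from c p (xor_from c p z))"
  then show "xor_from c p (xor_from c p z) ! q = z ! q"
    using assms[of q] by (auto simp: nth_xor_from)
qed simp

lemma run_fan_out_layer:
  assumes "set cs \<subseteq> {..<p}" "p \<le> length z"
    and c: "\<And>q. p \<le> q \<Longrightarrow> q < length z \<Longrightarrow> c q \<in> set cs"
    and "distinct cs"
  shows "run_layer (fan_out_layer c p (length z) cs) \<psi> z = \<psi> (xor_from c p z)"
proof -
  \<comment> \<open>The effect of the controls in \<open>cs\<close> alone, which makes an induction
    on the list of gates possible.\<close>
  define s where "s cs = map (\<lambda>q. if p \<le> q \<and> c q \<in> set cs then z ! q \<noteq> z ! c q else z ! q)
    [0..<length z]" for cs
  have "run_layer (fan_out_layer c p (length z) cs) \<psi> z = \<psi> (s cs)"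
    using assms(1,4)
  proof (induction cs arbitrary: \<psi>)
    case Nil
    have "s [] = z"
      by (simp add: s_def map_nth)
    then show ?case
      by (simp add: run_layer_def fan_out_layer_def)
  next
    case (Cons i cs)
    let ?ts = "filter (\<lambda>q. c q = i) [p..<length z]"
    have "run_layer (fan_out_layer c p (length z) (i # cs)) \<psi> z =
        apply_gate (Fan_Out ?ts i) \<psi> (s cs)"
      using Cons by (simp add: run_layer_def fan_out_layer_def)
    also have "\<dots> = \<psi> (map (\<lambda>q. if q \<in> set ?ts then s cs ! q \<noteq> s cs ! i else s cs ! q)
        [0..<length z])"
      using Cons.prems assms(2) by (subst apply_Fan_Out) (auto simp: s_def)
    \<comment> \<open>Distinctness of the controls ensures that the targets of \<open>i\<close> are
      still untouched in \<open>s cs\<close>, and \<open>i < p\<close> that the control is.\<close>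
    also have "map (\<lambda>q. if q \<in> set ?ts then s cs ! q \<noteq> s cs ! i else s cs ! q) [0..<length z] =
        s (i # cs)"
      using Cons.prems assms(2) by (intro nth_equalityI) (auto simp: s_def)
    finally show ?case .
  qed
  also have "s cs = xor_from c p z"
    using c by (auto simp: s_def xor_from_def)
  finally show ?thesis .
qed

section \<open>Product states and states of the registers\<close>

definition product_vector :: "nat \<Rightarrow> (nat \<Rightarrow> bool \<Rightarrow> complex) \<Rightarrow> amplitudes" where
  "product_vector m v = (\<lambda>y. if length y = m then \<Prod>k<m. v k (y ! k) else 0)"

lemma product_vector_ket: "product_vector m (\<lambda>k b. if b then 0 else 1) = ket (zeros m)"
proof
  fix y :: bits
  have "(\<exists>k<m. y ! k) \<longleftrightarrow> y \<noteq> zeros m" if "length y = m"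
    using that by (auto simp: zeros_def list_eq_iff_nth_eq)
  then show "product_vector m (\<lambda>k b. if b then 0 else 1) y = ket (zeros m) y"
    by (auto simp: product_vector_def ket_def zeros_def)
qed

text \<open>The distributive law, obtained by splitting off the first bit; it makes the norm of a
  product vector the product of the norms.\<close>

lemma sum_bits_prod:
  fixes f :: "nat \<Rightarrow> bool \<Rightarrow> 'a :: comm_semiring_1"
  shows "(\<Sum>y | length y = m. \<Prod>k<m. f k (y ! k)) = (\<Prod>k<m. \<Sum>b\<in>UNIV. f k b)"
proof (induction m arbitrary: f)
  case (Suc m)
  have "{y :: bits. length y = Suc m} = (\<lambda>(b, y). b # y) ` (UNIV \<times> {y. length y = m})"
    by (force simp: length_Suc_conv)
  moreover have "inj_on (\<lambda>(b, y). b # y) (UNIV \<times> {y :: bits. length y = m})"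
    by (auto simp: inj_on_def)
  ultimately have "(\<Sum>y | length y = Suc m. \<Prod>k<Suc m. f k (y ! k)) =
      (\<Sum>b\<in>UNIV. \<Sum>y | length y = m. f 0 b * (\<Prod>k<m. f (Suc k) (y ! k)))"
    by (simp add: sum.reindex sum.cartesian_product prod.lessThan_Suc_shift case_prod_unfold
        del: prod.lessThan_Suc)
  also have "\<dots> = (\<Sum>b\<in>UNIV. f 0 b) * (\<Prod>k<m. \<Sum>b\<in>UNIV. f (Suc k) b)"
    by (simp only: Suc.IH[of "\<lambda>k. f (Suc k)"] sum_distrib_right flip: sum_distrib_left)
  finally show ?case
    by (simp add: prod.lessThan_Suc_shift del: prod.lessThan_Suc)
qed simp

lemma quantum_state_product_vector:
  assumes "\<And>k. k < m \<Longrightarrow> (\<Sum>b\<in>UNIV. cnj (v k b) * v k b) = 1"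
  shows "quantum_state m (product_vector m v)"
proof -
  have "braket m (product_vector m v) (product_vector m v) =
      (\<Sum>y | length y = m. \<Prod>k<m. cnj (v k (y ! k)) * v k (y ! k))"
    by (simp add: braket_def product_vector_def prod.distrib)
  also have "\<dots> = 1"
    using assms by (simp add: sum_bits_prod[of "\<lambda>k b. cnj (v k b) * v k b"])
  finally show ?thesis
    by (simp add: quantum_state_def product_vector_def)
qed

lemma braket_zeros_product_vector:
  "braket m (ket (zeros m)) (product_vector m v) = (\<Prod>k<m. v k False)"
proof -
  have "braket m (ket (zeros m)) (product_vector m v) =
      (\<Sum>z | length z = m. if z = zeros m then product_vector m v z else 0)"
    unfolding braket_def by (intro sum.cong) (auto simp: ket_def)
  also have "\<dots> = product_vector m v (zeros m)"
    using finite_bits[of m] by (simp add: zeros_def)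
  finally show ?thesis
    by (simp add: product_vector_def zeros_def)
qed

text \<open>Input \<open>x\<close>, output qubits in a product state, ancillas \<open>r\<close>,
  bracketed as in \<open>maps_to\<close>. The state has this form before and after
  \<open>kickback\<close> and each one-qubit layer on the outputs, so only \<open>v\<close> has to
  be tracked.\<close>

definition register_state :: "bits \<Rightarrow> nat \<Rightarrow> (nat \<Rightarrow> bool \<Rightarrow> complex) \<Rightarrow> bits \<Rightarrow> amplitudes" where
  "register_state x m v r =
     tensor (length x + m) (tensor (length x) (ket x) (product_vector m v)) (ket r)"

lemma register_state_apply:
  "register_state x m v r z =
    (if length z = length x + m + length r \<and> take (length x) z = x \<and> drop (length x + m) z = r
     then \<Prod>k<m. v k (z ! (length x + k)) else 0)"
  by (cases "length z < length x")
    (auto simp: register_state_def tensor_def ket_def product_vector_def min_def)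

lemma apply_One_Qubit_register_state:
  assumes "k < m"
  shows "apply_gate (One_Qubit U (length x + k)) (register_state x m v r) =
    register_state x m (v(k := \<lambda>b. \<Sum>c\<in>UNIV. U $ b $ c * v k c)) r" (is "?l = ?r")
proof
  fix z :: bits
  show "?l z = ?r z"
  proof (cases "length z = length x + m + length r")
    case True
    let ?p = "\<Prod>j\<in>{..<m} - {k}. v j (z ! (length x + j))"
    have split: "(\<Prod>j<m. f j) = f k * (\<Prod>j\<in>{..<m} - {k}. f j)" for f :: "nat \<Rightarrow> complex"
      using assms by (intro prod.remove) auto
    have "(\<Prod>j<m. v j (z[length x + k := b] ! (length x + j))) = v k b * ?p" for b
      unfolding split using True assms by (auto intro!: arg_cong2[where f = "(*)"] prod.cong)
    then have upd: "register_state x m v r (z[length x + k := b]) =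
        (if take (length x) z = x \<and> drop (length x + m) z = r then v k b * ?p else 0)" for b
      using True assms unfolding register_state_apply by simp
    let ?s = "\<Sum>c\<in>UNIV. U $ (z ! (length x + k)) $ c * v k c"
    have "?r z = (if take (length x) z = x \<and> drop (length x + m) z = r then ?s * ?p else 0)"
      unfolding register_state_apply split using True
      by (auto intro!: arg_cong2[where f = "(*)"] prod.cong)
    moreover have "?l z = (\<Sum>c\<in>UNIV. U $ (z ! (length x + k)) $ c *
        register_state x m v r (z[length x + k := c]))"
      using True assms by (intro apply_One_Qubit) simp
    ultimately show ?thesis
      unfolding upd by (auto simp: sum_distrib_right mult.assoc)
  next
    case False
    then show ?thesis
      by (auto simp: apply_gate_def register_state_apply intro!: sum.neutral)
  qed
qed

lemma run_one_qubit_layer_register_state: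
  assumes "length x = n"
  shows "run_layer (one_qubit_layer U n m) (register_state x m v r) =
    register_state x m (\<lambda>k b. \<Sum>c\<in>UNIV. U k $ b $ c * v k c) r"
proof -
  let ?w = "\<lambda>k b. \<Sum>c\<in>UNIV. U k $ b $ c * v k c"
  \<comment> \<open>Induction on the number of gates already applied: the factors below
    \<open>l\<close> are updated, the others are not.\<close>
  have "run_layer (one_qubit_layer U n l) (register_state x m v r) =
      register_state x m (\<lambda>k. if k < l then ?w k else v k) r" if "l \<le> m" for l
    using that
  proof (induction l)
    case (Suc l)
    have "(\<lambda>k. if k < l then ?w k else v k)(l := ?w l) = (\<lambda>k. if k < Suc l then ?w k else v k)"
      by auto
    then have "apply_gate (One_Qubit (U l) (n + l))
        (register_state x m (\<lambda>k. if k < l then ?w k else v k) r) =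
      register_state x m (\<lambda>k. if k < Suc l then ?w k else v k) r"
      using Suc.prems assms apply_One_Qubit_register_state[of l m "U l" x] by simp
    then show ?case
      using Suc by (simp add: run_layer_def one_qubit_layer_def)
  qed (simp add: run_layer_def one_qubit_layer_def)
  \<comment> \<open>The two families of vectors agree for \<open>k < m\<close>, and no other factor
    enters \<open>register_state\<close>.\<close>
  from this[of m] show ?thesis
    by (simp add: register_state_apply fun_eq_iff)
qed

section \<open>The circuit and its effect\<close>

definition angle :: "nat \<Rightarrow> real" where
  "angle k = pi / 2 ^ Suc k"

text \<open>The ancilla at position \<open>n + m + j\<close> holds a copy of the input bit \<open>j mod n\<close> for the output
  qubit \<open>n + j div n\<close>.\<close>

definition input_layer :: "nat \<Rightarrow> nat \<Rightarrow> layer" where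
  "input_layer n m =
     fan_out_layer (\<lambda>q. (q - (n + m)) mod n) (n + m) (n + m + m * n) [0..<n]"

definition output_layer :: "nat \<Rightarrow> nat \<Rightarrow> layer" where
  "output_layer n m =
     fan_out_layer (\<lambda>q. n + (q - (n + m)) div n) (n + m) (n + m + m * n) [n..<n + m]"

text \<open>A diagonal layer conjugated by permutations of basis strings, hence again diagonal:
  input and ancillas are restored and only a phase is left.\<close>

definition kickback :: "nat \<Rightarrow> nat \<Rightarrow> circuit" where
  "kickback n m = [input_layer n m, output_layer n m,
     one_qubit_layer (\<lambda>j. phase (- angle (j div n))) (n + m) (m * n),
     output_layer n m, input_layer n m]"

text \<open>The correcting phases of angle \<open>n * angle k\<close> may precede
  \<open>kickback\<close> because both are diagonal.\<close>

definition or_circuit :: "nat \<Rightarrow> nat \<Rightarrow> circuit" where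
  "or_circuit n m =
     [one_qubit_layer (\<lambda>k. hadamard) n m, one_qubit_layer (\<lambda>k. phase (real n * angle k)) n m] @
     kickback n m @ [one_qubit_layer (\<lambda>k. hadamard) n m]"

lemma valid_or_circuit: "valid_circuit (n + m + m * n) (or_circuit n m)"
proof -
  have "valid_layer (n + m + m * n) (input_layer n m)"
    "valid_layer (n + m + m * n) (output_layer n m)"
    unfolding input_layer_def output_layer_def by (rule valid_fan_out_layer; simp add: subset_eq)+
  moreover have "valid_layer (n + m + m * n) (one_qubit_layer U p l)"
    if "\<And>k. unitary (U k)" "p + l \<le> n + m + m * n" for U p l
    using that by (rule valid_one_qubit_layer)
  ultimately show ?thesis
    by (simp add: valid_circuit_def or_circuit_def kickback_def unitary_hadamard unitary_phase)
qed

text \<open>The exponent counts the ones of \<open>x\<close> after its bits are flipped (if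
  \<open>b\<close>) or kept.\<close>

lemma prod_xor_weight:
  fixes c :: "'a :: comm_monoid_mult"
  shows "(\<Prod>i<length x. if x ! i \<noteq> b then c else 1) =
    c ^ (if b then length x - hamming_weight x else hamming_weight x)"
proof (induction x)
  case (Cons a x)
  have "count_list x True \<le> length x"
    by (rule count_le_length)
  with Cons show ?case
    by (cases a; cases b)
      (simp_all add: prod.lessThan_Suc_shift hamming_weight_def Suc_diff_le del: prod.lessThan_Suc)
qed (simp add: hamming_weight_def)

text \<open>Writes \<open>j\<close> as \<open>k * n + i\<close>, cutting the range into
  \<open>m\<close> blocks of length \<open>n\<close>.\<close>

lemma prod_div_mod:
  fixes f :: "nat \<Rightarrow> nat \<Rightarrow> 'a :: comm_monoid_mult"
  shows "(\<Prod>j<m * n. f (j div n) (j mod n)) = (\<Prod>k<m. \<Prod>i<n. f k i)"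
proof -
  have "(\<Prod>j<m * n. f (j div n) (j mod n)) =
      (\<Prod>k<m. \<Prod>j = k * n..<k * n + n. f (j div n) (j mod n))"
    by (rule prod.nat_group[symmetric])
  also have "\<dots> = (\<Prod>k<m. \<Prod>i = 0..<n. f ((i + k * n) div n) ((i + k * n) mod n))"
    using prod.shift_bounds_nat_ivl[of "\<lambda>j. f (j div n) (j mod n)" 0 "k * n" n for k]
    by (simp add: add.commute)
  also have "\<dots> = (\<Prod>k<m. \<Prod>i<n. f k i)"
    by (intro prod.cong) (auto simp: atLeast0LessThan)
  finally show ?thesis .
qed

text \<open>Read from the last layer, the argument goes from \<open>z\<close> to \<open>s z\<close>
  and \<open>t (s z)\<close>, picks up the phase there and returns to \<open>z\<close> because
  \<open>s\<close> and \<open>t\<close> are involutions.\<close>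

lemma run_kickback:
  assumes "length z = n + m + m * n"
  shows "run_circuit (kickback n m) \<psi> z =
    (\<Prod>k<m. \<Prod>i<n. if (z ! (n + m + (k * n + i)) \<noteq> z ! i) \<noteq> z ! (n + k)
      then cis (- angle k) else 1) * \<psi> z"
proof -
  let ?p = "n + m" and ?N = "n + m + m * n"
  define s where "s = xor_from (\<lambda>q. (q - ?p) mod n) ?p"
  define t where "t = xor_from (\<lambda>q. n + (q - ?p) div n) ?p"
  have cs: "(q - ?p) mod n < n" and ct: "(q - ?p) div n < m" if "?p \<le> q" "q < ?N" for q
  proof -
    have *: "q - ?p < m * n"
      using that by arith
    then show "(q - ?p) div n < m"
      by (rule less_mult_imp_div_less)
    \<comment> \<open>An ancilla position exists, which excludes \<open>n = 0\<close>, where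
      \<open>mod n\<close> would give no bound.\<close>
    from * have "0 < n"
      by (cases n) auto
    then show "(q - ?p) mod n < n"
      by simp
  qed
  have S: "run_layer (input_layer n m) \<psi> w = \<psi> (s w)" if "length w = ?N" for w \<psi>
    using that cs run_fan_out_layer[of "[0..<n]" ?p w "\<lambda>q. (q - ?p) mod n" \<psi>]
    by (simp add: input_layer_def s_def subset_eq)
  have T: "run_layer (output_layer n m) \<psi> w = \<psi> (t w)" if "length w = ?N" for w \<psi>
    using that ct run_fan_out_layer[of "[n..<n + m]" ?p w "\<lambda>q. n + (q - ?p) div n" \<psi>]
    by (simp add: output_layer_def t_def subset_eq)
  have ss: "s (s w) = w" and tt: "t (t w) = w" if "length w = ?N" for w
    using that cs ct unfolding s_def t_def
    by (intro xor_from_involution; fastforce)+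
  have len: "length (s w) = length w" "length (t w) = length w" for w
    by (simp_all add: s_def t_def)
  have bit: "t (s z) ! (?p + j) = ((z ! (?p + j) \<noteq> z ! (j mod n)) \<noteq> z ! (n + j div n))"
    if "j < m * n" for j
    using that assms cs[of "?p + j"] ct[of "?p + j"] by (simp add: s_def t_def nth_xor_from)
  have "run_circuit (kickback n m) \<psi> z =
      (\<Prod>j<m * n. if t (s z) ! (?p + j) then cis (- angle (j div n)) else 1) * \<psi> z"
    using assms by (simp add: run_circuit_def kickback_def S T len ss tt run_phase_layer)
  also have "(\<Prod>j<m * n. if t (s z) ! (?p + j) then cis (- angle (j div n)) else 1) =
      (\<Prod>j<m * n. (\<lambda>k i. if (z ! (?p + (k * n + i)) \<noteq> z ! i) \<noteq> z ! (n + k)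
        then cis (- angle k) else 1) (j div n) (j mod n))"
    by (intro prod.cong) (simp_all add: bit)
  finally show ?thesis
    by (simp only: prod_div_mod[of "\<lambda>k i. if (z ! (?p + (k * n + i)) \<noteq> z ! i) \<noteq> z ! (n + k)
        then cis (- angle k) else 1"])
qed

lemma run_kickback_register_state:
  assumes "length x = n"
  shows "run_circuit (kickback n m) (register_state x m v (zeros (m * n))) =
    register_state x m (\<lambda>k b. cis (- angle k) ^ (if b then n - hamming_weight x
      else hamming_weight x) * v k b) (zeros (m * n))" (is "run_circuit _ ?\<psi> = ?r")
proof
  fix z :: bits
  show "run_circuit (kickback n m) ?\<psi> z = ?r z"
  proof (cases "length z = n + m + m * n")
    case True
    show ?thesis
    proof (cases "take n z = x \<and> drop (n + m) z = zeros (m * n)")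
      case nz: True
      have anc: "\<not> z ! (n + m + (k * n + i))" if "k < m" "i < n" for k i
      proof -
        have "k * n + i < Suc k * n"
          using that by simp
        also have "\<dots> \<le> m * n"
          using that by (intro mult_le_mono1) simp
        finally have lt: "k * n + i < m * n" .
        have "z ! (n + m + (k * n + i)) = drop (n + m) z ! (k * n + i)"
          using True by simp
        then show ?thesis
          using lt nz by (simp add: zeros_def)
      qed
      have inp: "z ! i = x ! i" if "i < n" for i
        using nz that by (metis nth_take)
      have "(\<Prod>k<m. \<Prod>i<n. if (z ! (n + m + (k * n + i)) \<noteq> z ! i) \<noteq> z ! (n + k)
            then cis (- angle k) else 1) =
          (\<Prod>k<m. \<Prod>i<length x. if x ! i \<noteq> z ! (n + k) then cis (- angle k) else 1)"
        using assms by (intro prod.cong) (auto simp: anc inp)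
      also have "\<dots> = (\<Prod>k<m. cis (- angle k) ^ (if z ! (n + k) then n - hamming_weight x
          else hamming_weight x))"
        by (simp only: prod_xor_weight) (simp add: assms cong: if_cong)
      finally show ?thesis
        using True nz assms
        by (simp only: run_kickback) (simp add: register_state_apply prod.distrib zeros_def)
    next
      \<comment> \<open>By \<open>run_kickback\<close> the amplitude at \<open>z\<close> is only
        multiplied by a scalar, so it stays zero.\<close>
      case False
      then show ?thesis
        using True assms by (auto simp: run_kickback register_state_apply)
    qed
  next
    case False
    have "run_circuit C \<psi> z = 0" if "\<And>z. length z \<noteq> n + m + m * n \<Longrightarrow> \<psi> z = 0" for C \<psi>
      using that False unfolding run_circuit_def
    proof (induction C arbitrary: \<psi>)
      case (Cons L C)
      then show ?case
        using run_layer_support[of "n + m + m * n" \<psi>] by simp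
    qed simp
    then show ?thesis
      using False assms by (auto simp: register_state_apply zeros_def)
  qed
qed

lemma run_or_circuit:
  assumes "length x = n"
  defines "w \<equiv> real (hamming_weight x)"
  shows "run_circuit (or_circuit n m)
      (register_state x m (\<lambda>k b. if b then 0 else 1) (zeros (m * n))) =
    register_state x m (\<lambda>k b. if b then - \<i> * sin (w * angle k) else cos (w * angle k))
      (zeros (m * n))"
proof -
  have le: "hamming_weight x \<le> n"
    using assms count_le_length[of x True] by (simp add: hamming_weight_def)
  have pow: "cis (- t) ^ j = cis (- (real j * t))" for t j
    by (simp only: Complex.DeMoivre mult_minus_right)
  \<comment> \<open>For output bit 1 the correction turns \<open>-(n - w) * t\<close> into
    \<open>w * t\<close>, making the phases of the two branches opposite.\<close>
  have cmb: "cis (- (real (n - hamming_weight x) * t)) * cis (real n * t) = cis (w * t)" for t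
    using le by (simp add: cis_mult w_def of_nat_diff algebra_simps)
  let ?u = "\<lambda>k b. cis (if b then w * angle k else - (w * angle k)) / complex_of_real (sqrt 2)"
  let ?R = "\<lambda>v. register_state x m v (zeros (m * n))"
  have "run_layer (one_qubit_layer (\<lambda>k. hadamard) n m) (?R (\<lambda>k b. if b then 0 else 1)) =
      ?R (\<lambda>k b. 1 / complex_of_real (sqrt 2))"
    unfolding run_one_qubit_layer_register_state[OF assms(1)]
    by (intro arg_cong[where f = ?R] ext) (simp add: UNIV_bool hadamard_def)
  moreover have "run_layer (one_qubit_layer (\<lambda>k. phase (real n * angle k)) n m)
      (?R (\<lambda>k b. 1 / complex_of_real (sqrt 2))) =
      ?R (\<lambda>k b. (if b then cis (real n * angle k) else 1) / complex_of_real (sqrt 2))"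
    unfolding run_one_qubit_layer_register_state[OF assms(1)]
    by (intro arg_cong[where f = ?R] ext) (simp add: UNIV_bool phase_def)
  ultimately have "run_circuit (or_circuit n m) (?R (\<lambda>k b. if b then 0 else 1)) =
    run_layer (one_qubit_layer (\<lambda>k. hadamard) n m) (run_circuit (kickback n m)
      (?R (\<lambda>k b. (if b then cis (real n * angle k) else 1) / complex_of_real (sqrt 2))))"
    by (simp add: or_circuit_def run_circuit_append run_circuit_Cons run_circuit_Nil)
  also have "run_circuit (kickback n m)
      (?R (\<lambda>k b. (if b then cis (real n * angle k) else 1) / complex_of_real (sqrt 2))) = ?R ?u"
    unfolding run_kickback_register_state[OF assms(1)]
    by (intro arg_cong[where f = ?R] ext) (simp add: pow cmb w_def)
  \<comment> \<open>Interference of opposite phases: half their sum is the cosine, half their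
    difference is \<open>-\<i>\<close> times the sine.\<close>
  also have "run_layer (one_qubit_layer (\<lambda>k. hadamard) n m) (?R ?u) =
      ?R (\<lambda>k b. if b then - \<i> * sin (w * angle k) else cos (w * angle k))"
    unfolding run_one_qubit_layer_register_state[OF assms(1)]
    by (intro arg_cong[where f = ?R] ext)
      (auto simp: UNIV_bool hadamard_def complex_eq_iff)
  finally show ?thesis .
qed

section \<open>Exactness of the reduction\<close>

lemma angle_multiple_odd:
  assumes "0 < w" "w < 2 ^ m"
  shows "\<exists>k<m. cos (real w * angle k) = 0"
proof -
  \<comment> \<open>The 2-adic valuation of \<open>w\<close> selects the output qubit:
    \<open>w * angle k\<close> is then \<open>u * pi / 2\<close> with \<open>u\<close> odd.\<close>
  obtain k u where w: "w = 2 ^ k * u" and "odd u"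
    using assms(1) multiplicity_decompose'[of w 2] by (metis gr0_conv_Suc nat.distinct(1) odd_one)
  then obtain b where u: "u = 2 * b + 1"
    by (auto elim: oddE)
  have "(2::nat) ^ k \<le> w"
    using w u by simp
  then have "(2::nat) ^ k < 2 ^ m"
    using assms(2) by linarith
  then have "k < m"
    by simp
  moreover have "real w * angle k = real b * pi + pi / 2"
    by (simp add: w u angle_def field_simps)
  then have "cos (real w * angle k) = 0"
    by (simp add: cos_add)
  ultimately show ?thesis
    by blast
qed

text \<open>For weight 0 all angles vanish and each output qubit returns to zero. Otherwise the
  weight is positive and at most \<open>n < 2 ^ m\<close>, so some factor of the overlap with the
  zero state is 0.\<close>

lemma or_circuit_reduces_Or:
  assumes "n < 2 ^ m"
  shows "reduces_Or_exactly n m (m * n) (or_circuit n m)"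
  unfolding reduces_Or_exactly_def
proof (intro allI impI)
  fix x :: bits
  assume x: "length x = n"
  let ?w = "hamming_weight x"
  define v where "v k b =
    (if b then - \<i> * sin (real ?w * angle k) else complex_of_real (cos (real ?w * angle k)))"
    for k b
  let ?\<phi> = "product_vector m v"
  have "quantum_state m ?\<phi>"
  proof (rule quantum_state_product_vector)
    fix k
    have "complex_of_real (sin t) * sin t + complex_of_real (cos t) * cos t = 1" for t
      by (metis of_real_1 of_real_add of_real_mult power2_eq_square sin_cos_squared_add)
    then show "(\<Sum>b\<in>UNIV. cnj (v k b) * v k b) = 1"
      by (simp add: v_def UNIV_bool algebra_simps)
  qed
  moreover have "maps_to (n + m) (m * n) (or_circuit n m)
      (tensor n (ket x) (ket (zeros m))) (tensor n (ket x) ?\<phi>)"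
    using run_or_circuit[OF x, of m] x
    by (simp add: maps_to_def register_state_def product_vector_ket v_def[abs_def])
  moreover have "?\<phi> = ket (zeros m)" if "?w = 0"
    using that product_vector_ket[of m] by (simp add: v_def[abs_def] if_distrib cong: if_cong)
  moreover have "braket m (ket (zeros m)) ?\<phi> = 0" if nz: "?w \<noteq> 0"
  proof -
    have "?w < 2 ^ m"
      using assms x count_le_length[of x True] by (simp add: hamming_weight_def)
    then obtain k where "k < m" "v k False = 0"
      using angle_multiple_odd[of ?w m] nz by (auto simp: v_def)
    then show ?thesis
      by (auto simp: braket_zeros_product_vector)
  qed
  ultimately show "\<exists>\<phi>. quantum_state m \<phi> \<and>
      maps_to (n + m) (m * n) (or_circuit n m) (tensor n (ket x) (ket (zeros m)))
        (tensor n (ket x) \<phi>) \<and>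
      (?w = 0 \<longrightarrow> \<phi> = ket (zeros m)) \<and> (?w \<noteq> 0 \<longrightarrow> braket m (ket (zeros m)) \<phi> = 0)"
    by (intro exI[of _ ?\<phi>] conjI impI)
qed

section \<open>Depth and size of the circuit family\<close>

lemma depth_or_circuit: "circuit_depth (or_circuit n m) = 8"
  by (simp add: circuit_depth_def or_circuit_def kickback_def)

theorem lemma18:
  shows "\<exists>(d :: nat) (a :: nat \<Rightarrow> nat) (C :: nat \<Rightarrow> circuit).
    (\<forall>n. let m = nat \<lceil>log 2 (real n + 1)\<rceil> in
       valid_circuit (n + m + a n) (C n) \<and> circuit_depth (C n) \<le> d \<and>
       reduces_Or_exactly n m (a n) (C n)) \<and>
    (\<lambda>n. real (circuit_size (C n))) \<in> O(\<lambda>n. real n * log 2 (real n))"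
proof -
  define m where "m n = nat \<lceil>log 2 (real n + 1)\<rceil>" for n
  have m_bound: "n < 2 ^ m n" for n
  proof -
    have "log 2 (real n + 1) \<le> m n"
      unfolding m_def by linarith
    then have "real n + 1 \<le> 2 powr m n"
      by (simp add: log_le_iff)
    then have "real n + 1 \<le> real (2 ^ m n)"
      by (simp add: powr_realpow)
    then show ?thesis
      by linarith
  qed
  \<comment> \<open>The constant is \<open>8 * (1 + 3 + 3)\<close>: depth 8, and one summand for
    each of the terms \<open>n\<close>, \<open>m n\<close> and \<open>m n * n\<close>.\<close>
  have size: "real (circuit_size (or_circuit n (m n))) \<le> 56 * (real n * log 2 (real n))"
    if n: "2 \<le> n" for n
  proof -
    let ?l = "log 2 (real n)"
    have l: "1 \<le> ?l"
      using n by simp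
    have "log 2 (real n + 1) \<le> log 2 (2 * real n)"
      using n by simp
    also have "\<dots> = 1 + ?l"
      using n by (subst log_mult) auto
    \<comment> \<open>Rounding up costs at most 1 more, so \<open>m n \<le> 2 + ?l\<close>, and
      \<open>1 \<le> ?l\<close> absorbs the 2; this is where \<open>2 \<le> n\<close>
      matters.\<close>
    finally have m: "real (m n) \<le> 3 * ?l"
      using l unfolding m_def by linarith
    have "circuit_size (or_circuit n (m n)) \<le> 8 * (n + m n + m n * n)"
      using valid_circuit_size[OF valid_or_circuit[of n "m n"]] by (simp add: depth_or_circuit)
    then have "real (circuit_size (or_circuit n (m n))) \<le> real (8 * (n + m n + m n * n))"
      by (simp only: of_nat_le_iff)
    also have "\<dots> = 8 * (real n * 1 + 1 * real (m n) + real n * real (m n))"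
      by (simp add: algebra_simps)
    also have "\<dots> \<le> 8 * (real n * ?l + real n * (3 * ?l) + real n * (3 * ?l))"
      using n m l by (intro mult_left_mono add_mono mult_mono) auto
    finally show ?thesis
      by simp
  qed
  have "(\<lambda>n. real (circuit_size (or_circuit n (m n)))) \<in> O(\<lambda>n. real n * log 2 (real n))"
  proof (rule bigoI)
    show "\<forall>\<^sub>F n in sequentially. norm (real (circuit_size (or_circuit n (m n))))
        \<le> 56 * norm (real n * log 2 (real n))"
      using eventually_ge_at_top[of 2]
    proof eventually_elim
      case (elim n)
      then have "0 \<le> log 2 (real n)"
        by simp
      with size[OF elim] show ?case
        by simp
    qed
  qed
  then show ?thesis
    using valid_or_circuit or_circuit_reduces_Or[OF m_bound] depth_or_circuit
    \<comment> \<open>One ancilla for each pair of an input and an output qubit.\<close>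
    by (intro exI[of _ 8] exI[of _ "\<lambda>n. m n * n"] exI[of _ "\<lambda>n. or_circuit n (m n)"])
      (simp add: Let_def flip: m_def)
qed

end
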